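(* Let $(b_n)_{n\ge1}$ be a sequence of nonnegative real numbers with $(b_n)\in GM(\beta^{\ast},2)$. Then the series $$\sum_{n=1}^{\infty}b_n\sin nx$$ converges uniformly in $x\in\mathbb{R}$ if and only if $nb_n\to0$ as $n\to\infty$.
   Context: $\mathbb{N}=\{1,2,3,\dots\}$ and $[x]$ denotes the integer part of $x$. Sequences $a=(a_n)_{n\ge 1}$ are sequences of complex numbers indexed by the positive integers. For $r\in\mathbb{N}$, the class $GM(\beta^{\ast},r)$ is the set of all complex sequences $a=(a_n)$ for which there exist a real number $c>1$ and a constant $K(a)$ (both may depend on the sequence $a$, but not on $m$) such that for all $m\in\mathbb{N}$ $$\sum_{n=m}^{2m-1}|a_n-a_{n+r}|\le K(a)\,\beta^{\ast}_m,\qquad \beta^{\ast}_m=\sum_{k=m}^{m+r-1}|a_k|+\sum_{k=[m/c]}^{[cm]}\frac{|a_k|}{k}.$$ In the last sum only indices $k\ge 1$ are taken (i.e. if $[m/c]=0$ the sum starts at $k=1$). Here the class is used with $r=2$. *)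

theory Defs
  imports "HOL-Analysis.Analysis"
begin

(* A sequence indexed by the positive integers is a function on nat whose value at 0 is
   irrelevant: no index 0 occurs below. *)

definition beta_star :: "nat \<Rightarrow> real \<Rightarrow> (nat \<Rightarrow> complex) \<Rightarrow> nat \<Rightarrow> real" where
  "beta_star r c a m =
     (\<Sum>k = m..m + r - 1. cmod (a k)) +
     (\<Sum>k = max 1 (nat \<lfloor>real m / c\<rfloor>)..nat \<lfloor>c * real m\<rfloor>. cmod (a k) / real k)"

definition GM_beta_star :: "nat \<Rightarrow> (nat \<Rightarrow> complex) set" where
  "GM_beta_star r =
     {a. \<exists>c K :: real. c > 1 \<and>
        (\<forall>m\<ge>1. (\<Sum>n = m..2 * m - 1. cmod (a n - a (n + r))) \<le> K * beta_star r c a m)}"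

end

(* Sufficiency: if n b_n is small from some index on, the GM condition bounds the variation of
   step 2 over a dyadic block starting at m by o(1/m), and summing geometrically the same holds for
   the whole tail. Let s = |sin x| and split the sum at N = [1/s]. For n <= N use
   |sin nx| <= n s; beyond N, sum by parts after multiplying by
   2 sin x sin nx = cos (n-1)x - cos (n+1)x. Measuring with |sin x| instead of |x| treats the
   neighbourhoods of 0 and of pi at once.

   Necessity: at x = 1/q the sines are comparable to 1 for indices n <= q comparable to q, so window
   sums of b tend to 0. By GM, b_m is at most a constant times b_v + b_(v+1) plus a window average,
   for every v in [m/2, m]; averaging over v bounds m b_m by a window sum. *)

theory Submission
  imports Defs
begin

section \<open>Sine inequalities and summation by parts with step 2\<close>

lemma abs_sin_nat_mult_le: "\<bar>sin (real n * x)\<bar> \<le> real n * \<bar>sin x\<bar>"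
proof (induction n)
  case (Suc n)
  have "\<bar>sin (real (Suc n) * x)\<bar> = \<bar>sin (real n * x) * cos x + cos (real n * x) * sin x\<bar>"
    by (simp add: distrib_right sin_add algebra_simps)
  also have "\<dots> \<le> \<bar>sin (real n * x)\<bar> * \<bar>cos x\<bar> + \<bar>cos (real n * x)\<bar> * \<bar>sin x\<bar>"
    by (metis abs_mult abs_triangle_ineq)
  also have "\<dots> \<le> \<bar>sin (real n * x)\<bar> * 1 + 1 * \<bar>sin x\<bar>"
    by (intro add_mono mult_mono) auto
  also have "\<dots> \<le> real (Suc n) * \<bar>sin x\<bar>"
    using Suc by (simp add: algebra_simps)
  finally show ?case .
qed simp

text \<open>The Taylor remainder gives |sin x - x| \<le> x^3/6 \<le> x/6 on the unit interval, so
  the factor 1/2 is generous. It keeps the sines at the test point 1/q away from 0 in the necessity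
  part.\<close>

lemma sin_ge_half:
  fixes x :: real
  assumes "0 \<le> x" "x \<le> 1"
  shows "x / 2 \<le> sin x"
proof -
  have "\<bar>sin x - x\<bar> \<le> inverse (fact 3) * \<bar>x\<bar> ^ 3"
    using Maclaurin_sin_bound[of x 3] by (simp add: sin_coeff_def eval_nat_numeral)
  also have "\<bar>x\<bar> ^ 3 \<le> \<bar>x\<bar> ^ 1"
    using assms by (intro power_decreasing) auto
  finally have "\<bar>sin x - x\<bar> \<le> x / 6"
    using assms by (simp add: fact_numeral)
  then show ?thesis using assms by linarith
qed

text \<open>Product-to-sum formula. A real \<open>t\<close> keeps the shift \<open>t - 1\<close>
  clear of truncated subtraction on nat.\<close>

lemma sin_mult_sin_shift:
  fixes t x :: real
  shows "2 * sin x * (u * sin (t * x)) = u * (cos ((t - 1) * x) - cos ((t + 1) * x))"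
proof -
  have "(t - 1) * x = t * x - x" "(t + 1) * x = t * x + x"
    by (simp_all add: algebra_simps)
  then show ?thesis by (simp add: cos_diff cos_add)
qed

text \<open>The two cosines produced by each term have indices two apart. Collecting equal cosines
  therefore leaves differences of step 2, the ones that the class with r = 2 controls, and two
  boundary terms at each end.\<close>

lemma sum_sin_by_parts:
  fixes b :: "nat \<Rightarrow> real"
  assumes "p \<le> q"
  shows "2 * sin x * (\<Sum>n=p..q. b n * sin (real n * x)) =
     b p * cos ((real p - 1) * x) + b (p+1) * cos (real p * x)
     - b (q+1) * cos (real q * x) - b (q+2) * cos ((real q + 1) * x)
     - (\<Sum>n=p..q. (b n - b (n+2)) * cos ((real n + 1) * x))"
  using assms
proof (induction q rule: dec_induct)
  case base
  show ?case using sin_mult_sin_shift[of x "b p" "real p"] by (simp add: algebra_simps)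
next
  case (step q)
  have "real (Suc q) - 1 = real q" "real (Suc q) + 1 = real q + 2" by simp_all
  then have "2 * sin x * (b (Suc q) * sin (real (Suc q) * x))
      = b (Suc q) * (cos (real q * x) - cos ((real q + 2) * x))"
    using sin_mult_sin_shift[of x "b (Suc q)" "real (Suc q)"] by (simp only:)
  moreover have "2 * sin x * (\<Sum>n=p..Suc q. b n * sin (real n * x))
      = 2 * sin x * (\<Sum>n=p..q. b n * sin (real n * x)) + 2 * sin x * (b (Suc q) * sin (real (Suc q) * x))"
    using step by (simp add: distrib_left)
  moreover have "(\<Sum>n=p..Suc q. (b n - b (n+2)) * cos ((real n + 1) * x))
      = (\<Sum>n=p..q. (b n - b (n+2)) * cos ((real n + 1) * x))
        + (b (q+1) - b (q+3)) * cos ((real q + 2) * x)"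
    using step by (simp add: eval_nat_numeral add.commute)
  moreover have "Suc q + 1 = q + 2" "Suc q + 2 = q + 3" "real (Suc q) = real q + 1"
    "real q + 1 + 1 = real q + 2" "Suc q = q + 1" by simp_all
  ultimately show ?case
    by (simp only: step.IH left_diff_distrib right_diff_distrib)
qed

lemma abs_sum_sin_by_parts_le:
  fixes b :: "nat \<Rightarrow> real"
  assumes "p \<le> q"
  shows "2 * \<bar>sin x\<bar> * \<bar>\<Sum>n=p..q. b n * sin (real n * x)\<bar> \<le>
     \<bar>b p\<bar> + \<bar>b (p+1)\<bar> + \<bar>b (q+1)\<bar> + \<bar>b (q+2)\<bar> + (\<Sum>n=p..q. \<bar>b n - b (n+2)\<bar>)"
proof -
  have le: "\<bar>u * cos v\<bar> \<le> \<bar>u\<bar>" for u v :: real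
    by (simp add: abs_mult mult_left_le)
  have tri: "\<bar>u + v - w - z - t\<bar> \<le> \<bar>u\<bar> + \<bar>v\<bar> + \<bar>w\<bar> + \<bar>z\<bar> + \<bar>t\<bar>" for u v w z t :: real
    by linarith
  have "2 * \<bar>sin x\<bar> * \<bar>\<Sum>n=p..q. b n * sin (real n * x)\<bar>
      = \<bar>2 * sin x * (\<Sum>n=p..q. b n * sin (real n * x))\<bar>"
    by (simp add: abs_mult)
  also have "\<dots> \<le> \<bar>b p * cos ((real p - 1) * x)\<bar> + \<bar>b (p+1) * cos (real p * x)\<bar>
     + \<bar>b (q+1) * cos (real q * x)\<bar> + \<bar>b (q+2) * cos ((real q + 1) * x)\<bar>
     + \<bar>\<Sum>n=p..q. (b n - b (n+2)) * cos ((real n + 1) * x)\<bar>"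
    unfolding sum_sin_by_parts[OF assms] by (rule tri)
  also have "\<dots> \<le> \<bar>b p\<bar> + \<bar>b (p+1)\<bar> + \<bar>b (q+1)\<bar> + \<bar>b (q+2)\<bar> + (\<Sum>n=p..q. \<bar>b n - b (n+2)\<bar>)"
    by (intro add_mono le order.trans[OF sum_abs sum_mono])
  finally show ?thesis .
qed

text \<open>The total 4 \<open>\<eta>\<close> is \<open>\<eta>\<close> for the indices up to
  \<open>N\<close> plus 3 \<open>\<eta>\<close> for those beyond. The factors \<open>real n\<close>
  and \<open>real p\<close> in the hypotheses balance the size of 1/s, so the bound does not depend
  on x.\<close>

lemma sine_block_bound:
  fixes b :: "nat \<Rightarrow> real" and \<eta> :: real
  assumes M: "1 \<le> M" and \<eta>: "0 \<le> \<eta>"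
    and small: "\<And>n. M \<le> n \<Longrightarrow> real n * \<bar>b n\<bar> \<le> \<eta>"
    and var: "\<And>p q. M \<le> p \<Longrightarrow> p \<le> q \<Longrightarrow> real p * (\<Sum>n=p..q. \<bar>b n - b (n+2)\<bar>) \<le> \<eta>"
    and "M \<le> p"
  shows "\<bar>\<Sum>n=p..q. b n * sin (real n * x)\<bar> \<le> 4 * \<eta>"
proof (cases "sin x = 0")
  case True
  then have "sin (real n * x) = 0" for n
    using abs_sin_nat_mult_le[of n x] by simp
  then show ?thesis using \<eta> by simp
next
  case False
  define s where "s = \<bar>sin x\<bar>"
  have s: "s > 0" using False by (simp add: s_def)
  \<comment> \<open>The crossover index: \<open>N\<close> * s \<le> 1 < (\<open>N\<close> + 1) * s,
    as the next facts record.\<close>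
  define N where "N = nat \<lfloor>1 / s\<rfloor>"
  have Ns: "real N * s \<le> 1"
    using s of_nat_floor[of "1/s"] by (simp only: N_def pos_le_divide_eq divide_nonneg_pos)
  have "1 / s < real N + 1"
    unfolding N_def by linarith
  then have sN: "1 < (real N + 1) * s" using s by (simp add: field_simps)
  have low: "\<bar>\<Sum>n=u..v. b n * sin (real n * x)\<bar> \<le> \<eta>" if "M \<le> u" "v \<le> N" for u v
  proof -
    have "\<bar>\<Sum>n=u..v. b n * sin (real n * x)\<bar> \<le> (\<Sum>n=u..v. \<eta> * s)"
    proof (rule order.trans[OF sum_abs sum_mono])
      fix n assume n: "n \<in> {u..v}"
      have "\<bar>b n * sin (real n * x)\<bar> \<le> \<bar>b n\<bar> * (real n * s)"
        unfolding abs_mult s_def by (intro mult_left_mono abs_sin_nat_mult_le) simp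
      also have "\<dots> = (real n * \<bar>b n\<bar>) * s" by simp
      also have "\<dots> \<le> \<eta> * s"
        using small[of n] n that s by (intro mult_right_mono) auto
      finally show "\<bar>b n * sin (real n * x)\<bar> \<le> \<eta> * s" .
    qed
    also have "\<dots> = real (card {u..v}) * s * \<eta>" by simp
    \<comment> \<open>Since \<open>u\<close> \<ge> \<open>M\<close> \<ge> 1, the block misses index
      0 and has at most \<open>N\<close> elements.\<close>
    also have "\<dots> \<le> real N * s * \<eta>"
      using that M s \<eta> by (intro mult_right_mono) auto
    also have "\<dots> \<le> \<eta>" using Ns \<eta> by (simp add: mult_left_le_one_le s less_imp_le)
    finally show ?thesis .
  qed
  have high: "\<bar>\<Sum>n=u..v. b n * sin (real n * x)\<bar> \<le> 3 * \<eta>" if "M \<le> u" "N < u" for u v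
  proof (cases "u \<le> v")
    case True
    let ?S = "\<bar>\<Sum>n=u..v. b n * sin (real n * x)\<bar>"
    have b: "real u * \<bar>b n\<bar> \<le> \<eta>" if "u \<le> n" for n
    proof -
      have "real u * \<bar>b n\<bar> \<le> real n * \<bar>b n\<bar>" using that by (intro mult_right_mono) auto
      also have "\<dots> \<le> \<eta>" using small that \<open>M \<le> u\<close> by simp
      finally show ?thesis .
    qed
    have "(real N + 1) * s \<le> real u * s"
      using that s by (intro mult_right_mono) auto
    then have "1 < real u * s" using sN by linarith
    then have "2 * ?S \<le> 2 * (real u * s) * ?S"
      by (intro mult_right_mono) auto
    also have "\<dots> = real u * (2 * s * ?S)" by simp
    also have "\<dots> \<le> real u * (\<bar>b u\<bar> + \<bar>b (u+1)\<bar> + \<bar>b (v+1)\<bar> + \<bar>b (v+2)\<bar> + (\<Sum>n=u..v. \<bar>b n - b (n+2)\<bar>))"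
      unfolding s_def by (intro mult_left_mono abs_sum_sin_by_parts_le True) simp
    \<comment> \<open>Four boundary terms and the variation cost \<open>\<eta>\<close> each; halving
      leaves 5/2 \<open>\<eta>\<close>, rounded up to 3 \<open>\<eta>\<close>.\<close>
    also have "\<dots> \<le> \<eta> + \<eta> + \<eta> + \<eta> + \<eta>"
      unfolding distrib_left by (intro add_mono b var that True) (use True in auto)
    finally show ?thesis using \<eta> by simp
  qed (use \<eta> in simp)
  show ?thesis
  proof (cases "p \<le> N \<and> N \<le> q")
    case True
    then have "(\<Sum>n=p..q. b n * sin (real n * x))
        = (\<Sum>n=p..N. b n * sin (real n * x)) + (\<Sum>n=N+1..q. b n * sin (real n * x))"
      using sum.ub_add_nat[of p N _ "q - N"] by simp
    then show ?thesis using low[of p N] high[of "N+1" q] True \<open>M \<le> p\<close> by linarith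
  next
    case False
    then consider "N < p" | "q \<le> N" by linarith
    then show ?thesis using low[of p q] high[of p q] \<open>M \<le> p\<close> \<eta> by cases linarith+
  qed
qed

section \<open>Dyadic tails, integer parts and chains of step 2\<close>

text \<open>The block starting at 2^j p contributes at most D/(2^j p), and these bounds form a
  geometric series with sum 2D/p.\<close>

lemma dyadic_tail_bound:
  fixes d :: "nat \<Rightarrow> real" and D :: real
  assumes M: "1 \<le> M" and d: "\<And>n. 0 \<le> d n" and D: "0 \<le> D"
    and block: "\<And>m. M \<le> m \<Longrightarrow> real m * (\<Sum>n=m..2*m-1. d n) \<le> D"
    and "M \<le> p"
  shows "real p * (\<Sum>n=p..q. d n) \<le> 2 * D"
proof -
  have p: "real p > 0" using assms by simp
  \<comment> \<open>The exact partial geometric sum is carried along, because the bound 2D alone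
    would not survive the induction step.\<close>
  have *: "real p * (\<Sum>n=p..<2^j*p. d n) \<le> 2 * D * (1 - (1/2)^j)" for j
  proof (induction j)
    case (Suc j)
    let ?m = "2^j * p"
    have "p \<le> ?m" by simp
    then have "M \<le> ?m" using \<open>M \<le> p\<close> by linarith
    have "2 * ?m > 0" using p by simp
    then have "{?m..2*?m-1} = {?m..<2*?m}"
      by (metis Suc_pred' atLeastLessThanSuc_atLeastAtMost)
    with block[OF \<open>M \<le> ?m\<close>] have "real ?m * (\<Sum>n=?m..<2*?m. d n) \<le> D" by simp
    then have "real p * (\<Sum>n=?m..<2*?m. d n) \<le> D * (1/2)^j"
      by (simp add: field_simps power_divide)
    moreover have "(\<Sum>n=p..<2*?m. d n) = (\<Sum>n=p..<?m. d n) + (\<Sum>n=?m..<2*?m. d n)"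
      using \<open>p \<le> ?m\<close> by (simp add: sum.atLeastLessThan_concat)
    ultimately show ?case using Suc by (simp add: algebra_simps)
  qed simp
  \<comment> \<open>Crude but sufficient: \<open>q\<close> doublings of \<open>p\<close> \<ge> 1
    already pass \<open>q\<close>.\<close>
  have "q < 2^q" by (rule less_exp)
  moreover have "2^q \<le> 2^q * p" using p by simp
  ultimately have "q < 2^q * p" by linarith
  then have "{p..q} \<subseteq> {p..<2^q*p}" by auto
  then have "(\<Sum>n=p..q. d n) \<le> (\<Sum>n=p..<2^q*p. d n)"
    using d by (intro sum_mono2) auto
  then have "real p * (\<Sum>n=p..q. d n) \<le> 2 * D * (1 - (1/2)^q)"
    using *[of q] p by (meson mult_left_mono order.trans less_imp_le)
  also have "\<dots> \<le> 2 * D" using D by (simp add: mult_left_le)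
  finally show ?thesis .
qed

text \<open>With t = m/c \<ge> 2, [t] \<ge> t - 1 \<ge> t/2. Thus rounding costs the lower end of
  the GM window at most a factor 2.\<close>

lemma floor_divide_ge_half:
  fixes c :: real
  assumes "0 < c" "2 * c \<le> real m"
  shows "real m / (2 * c) \<le> real (nat \<lfloor>real m / c\<rfloor>)"
proof -
  have "1 \<le> real m / (2 * c)" using assms by (simp add: field_simps)
  then show ?thesis using real_of_int_floor_gt_diff_one[of "real m / c"] by linarith
qed

text \<open>Descending from \<open>\<nu> + d\<close> in steps of 2 ends at \<open>\<nu>\<close> or
  \<open>\<nu>+1\<close>, depending on the parity of \<open>d\<close>. Nonnegativity allows both
  values to be added, which makes the bound independent of parity.\<close>

lemma term_le_variation:
  fixes b :: "nat \<Rightarrow> real"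
  assumes "0 \<le> b \<nu>" "0 \<le> b (\<nu>+1)"
  shows "b (\<nu> + d) \<le> b \<nu> + b (\<nu>+1) + (\<Sum>n=\<nu>..<\<nu>+d. \<bar>b n - b (n+2)\<bar>)"
proof (induction d rule: induct_nat_012)
  case (ge2 d)
  have "b (\<nu> + Suc (Suc d)) \<le> b (\<nu> + d) + \<bar>b (\<nu> + d) - b (\<nu> + d + 2)\<bar>"
    by (simp add: numeral_2_eq_2)
  with ge2(1) show ?case by simp
qed (use assms in auto)

section \<open>The GM condition for nonnegative real sequences, and sufficiency\<close>

context
  fixes b :: "nat \<Rightarrow> real" and c K :: real
  assumes nonneg: "\<And>n. n \<ge> 1 \<Longrightarrow> b n \<ge> 0"
    and c: "c > 1" and K: "K \<ge> 0"
    and GM: "\<And>m. m \<ge> 1 \<Longrightarrow> (\<Sum>n=m..2*m-1. \<bar>b n - b (n+2)\<bar>) \<le>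
      K * (b m + b (m+1) + (\<Sum>k = max 1 (nat \<lfloor>real m / c\<rfloor>)..nat \<lfloor>c * real m\<rfloor>. b k / real k))"
begin

text \<open>For m \<ge> 2cM the window starts at or above m/(2c) \<ge> M, so smallness holds
  throughout it. Each b_k/k is then at most 4 c^2 \<open>\<eta>\<close> / m^2, and at most cm such
  terms give 4 c^3 \<open>\<eta>\<close> / m; the two leading terms account for the 2.\<close>

lemma beta_star_block_small:
  assumes M: "1 \<le> M" and \<eta>: "0 \<le> \<eta>" and small: "\<And>n. M \<le> n \<Longrightarrow> real n * b n \<le> \<eta>"
    and m: "2 * c * real M \<le> real m"
  shows "real m * (\<Sum>n=m..2*m-1. \<bar>b n - b (n+2)\<bar>) \<le> K * (2 + 4 * c^3) * \<eta>"
proof -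
  let ?I = "{max 1 (nat \<lfloor>real m / c\<rfloor>)..nat \<lfloor>c * real m\<rfloor>}"
  have "2 * c * 1 \<le> 2 * c * real M" using M c by (intro mult_left_mono) auto
  then have m2: "2 * c \<le> real m" using m by linarith
  have "1 * real M \<le> 2 * c * real M" using c by (intro mult_right_mono) auto
  then have Mm: "M \<le> m" using m by simp
  have mpos: "real m > 0" using M Mm by simp
  have b: "real m * b n \<le> \<eta>" if "m \<le> n" for n
  proof -
    have "real m * b n \<le> real n * b n" using that nonneg[of n] Mm M by (intro mult_right_mono) auto
    also have "\<dots> \<le> \<eta>" using small that Mm by simp
    finally show ?thesis .
  qed
  have "(\<Sum>k\<in>?I. b k / real k) \<le> (\<Sum>k\<in>?I. 4 * c^2 * \<eta> / (real m)^2)"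
  proof (rule sum_mono)
    fix k assume k: "k \<in> ?I"
    then have "nat \<lfloor>real m / c\<rfloor> \<le> k" by simp
    then have k2: "real m / (2*c) \<le> real k"
      using floor_divide_ge_half[of c m] m2 c by linarith
    have "real M \<le> real m / (2*c)" using m c by (simp add: field_simps)
    with k2 have "real M \<le> real k" by linarith
    then have bk: "real k * b k \<le> \<eta>" using small by simp
    have kpos: "real k > 0" using k by simp
    have "b k / real k = real k * b k / (real k)^2" using kpos by (simp add: power2_eq_square)
    also have "\<dots> \<le> \<eta> / (real k)^2" using bk by (intro divide_right_mono) auto
    also have "\<dots> \<le> \<eta> / (real m / (2*c))^2"
      using k2 \<eta> mpos kpos c
      by (intro divide_left_mono power_mono mult_pos_pos zero_less_power divide_pos_pos) auto
    also have "\<dots> = 4 * c^2 * \<eta> / (real m)^2"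
      by (simp add: power2_eq_square)
    finally show "b k / real k \<le> 4 * c^2 * \<eta> / (real m)^2" .
  qed
  also have "\<dots> = real (card ?I) * (4 * c^2 * \<eta> / (real m)^2)" by simp
  also have "\<dots> \<le> (c * real m) * (4 * c^2 * \<eta> / (real m)^2)"
  proof (intro mult_right_mono)
    have "card ?I \<le> nat \<lfloor>c * real m\<rfloor>" by simp
    then show "real (card ?I) \<le> c * real m"
      using of_nat_floor[of "c * real m"] c by (meson of_nat_mono order.trans zero_le_mult_iff
          less_imp_le of_nat_0_le_iff zero_less_one order.strict_trans)
  qed (use \<eta> in auto)
  also have "\<dots> = 4 * c^3 * \<eta> / real m"
    using mpos by (simp add: power2_eq_square power3_eq_cube)
  finally have I: "real m * (\<Sum>k\<in>?I. b k / real k) \<le> 4 * c^3 * \<eta>"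
    using mpos by (simp add: field_simps)
  have "real m * (\<Sum>n=m..2*m-1. \<bar>b n - b (n+2)\<bar>)
      \<le> real m * (K * (b m + b (m+1) + (\<Sum>k\<in>?I. b k / real k)))"
    using GM[of m] M Mm by (intro mult_left_mono) auto
  also have "\<dots> = K * (real m * b m + real m * b (m+1) + real m * (\<Sum>k\<in>?I. b k / real k))"
    by (simp add: algebra_simps)
  also have "\<dots> \<le> K * (\<eta> + \<eta> + 4 * c^3 * \<eta>)"
    by (intro mult_left_mono add_mono b I K) auto
  finally show ?thesis by (simp add: algebra_simps)
qed

lemma uniformly_convergent_if_tendsto:
  assumes lim: "(\<lambda>n. real n * b n) \<longlonglongrightarrow> 0"
  shows "uniformly_convergent_on UNIV (\<lambda>N x. \<Sum>n = 1..N. b n * sin (real n * x))"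
proof (rule Cauchy_uniformly_convergent, rule uniformly_Cauchy_onI')
  fix e :: real assume e: "e > 0"
  define D where "D = K * (2 + 4 * c^3)"
  have D: "D \<ge> 0" using K c by (simp add: D_def)
  \<comment> \<open>\<open>sine_block_bound\<close> will be applied with (2D + 1)
    \<open>\<eta>\<close>, which covers both the tail variation 2D \<open>\<eta>\<close> and the
    terms themselves. Its factor 4 then yields 4e/5 < e.\<close>
  define \<eta> where "\<eta> = e / (5 * (2 * D + 1))"
  have \<eta>: "\<eta> > 0" using e D by (simp add: \<eta>_def)
  obtain M0 where M0: "\<And>n. M0 \<le> n \<Longrightarrow> \<bar>real n * b n\<bar> < \<eta>"
    using LIMSEQ_D[OF lim \<eta>] by auto
  define M1 where "M1 = max 1 M0"
  have M1: "1 \<le> M1" "\<And>n. M1 \<le> n \<Longrightarrow> real n * b n \<le> \<eta>"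
    using M0 by (force simp: M1_def)+
  \<comment> \<open>Beyond \<open>M\<close>, the whole GM window of m lies in the range where n b_n
    \<le> \<open>\<eta>\<close>.\<close>
  define M where "M = nat \<lceil>2 * c * real M1\<rceil>"
  have M: "2 * c * real M1 \<le> real M" unfolding M_def by (rule real_nat_ceiling_ge)
  have "1 * real M1 \<le> 2 * c * real M1" using c by (intro mult_right_mono) auto
  then have MM1: "M1 \<le> M" using M by linarith
  have var: "real p * (\<Sum>n=p..q. \<bar>b n - b (n+2)\<bar>) \<le> 2 * (D * \<eta>)" if "M \<le> p" for p q
  proof (rule dyadic_tail_bound[of M])
    show "1 \<le> M" using MM1 M1 by simp
    show "real m * (\<Sum>n=m..2*m-1. \<bar>b n - b (n+2)\<bar>) \<le> D * \<eta>" if "M \<le> m" for m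
      unfolding D_def
      by (rule beta_star_block_small[OF M1(1) _ M1(2)]) (use \<eta> M that in auto)
  qed (use D \<eta> that in auto)
  have small: "real n * \<bar>b n\<bar> \<le> \<eta>" if "M \<le> n" for n
    using M1(2)[of n] that MM1 M1(1) nonneg[of n] by simp
  have block: "\<bar>\<Sum>n=p..q. b n * sin (real n * x)\<bar> \<le> 4 * ((2 * D + 1) * \<eta>)" if "M \<le> p" for p q x
  proof (rule sine_block_bound[OF _ _ _ _ that])
    show "1 \<le> M" using MM1 M1 by simp
    show "0 \<le> (2 * D + 1) * \<eta>" using D \<eta> by simp
    show "real n * \<bar>b n\<bar> \<le> (2 * D + 1) * \<eta>" if "M \<le> n" for n
      using small[OF that] D \<eta> by (simp add: distrib_right add_increasing)
    show "real p * (\<Sum>n=p..q. \<bar>b n - b (n+2)\<bar>) \<le> (2 * D + 1) * \<eta>" if "M \<le> p" for p q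
      using var[OF that, of q] \<eta> by (simp add: distrib_right)
  qed
  have "4 * ((2 * D + 1) * \<eta>) = 4 * e / 5" using D by (simp add: \<eta>_def field_simps)
  then have small_e: "4 * ((2 * D + 1) * \<eta>) < e" using e by linarith
  show "\<exists>M. \<forall>x\<in>UNIV. \<forall>m\<ge>M. \<forall>n>m. dist (\<Sum>n = 1..m. b n * sin (real n * x))
          (\<Sum>n = 1..n. b n * sin (real n * x)) < e"
  proof (intro exI[of _ M] ballI allI impI)
    fix x :: real and m n :: nat assume mn: "m \<ge> M" "n > m"
    have "(\<Sum>n = 1..n. b n * sin (real n * x))
        = (\<Sum>n = 1..m. b n * sin (real n * x)) + (\<Sum>n = m+1..n. b n * sin (real n * x))"
      using sum.ub_add_nat[of 1 m _ "n - m"] mn by simp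
    then show "dist (\<Sum>n = 1..m. b n * sin (real n * x)) (\<Sum>n = 1..n. b n * sin (real n * x)) < e"
      using block[of "m+1" x n] mn small_e by (simp add: dist_real_def)
  qed
qed

section \<open>Necessity\<close>

text \<open>Averaging over at least m/2 starting points \<open>\<nu>\<close> \<ge> m/2 doubles the
  constant 2(1 + K) + 4cK. The window begins at m/(4c) because [\<open>\<nu>\<close>/c] \<ge>
  \<open>\<nu>\<close>/(2c) \<ge> m/(4c); its extra \<open>+ 1\<close> makes room for
  b_(\<open>\<nu>\<close>+1) when \<open>\<nu>\<close> = m.\<close>

lemma term_le_window_sum:
  assumes m: "4 * c \<le> real m"
  shows "real m * b m \<le> (4 * (1 + K) + 8 * c * K) *
    (\<Sum>k = nat \<lceil>real m / (4 * c)\<rceil>..nat \<lfloor>c * real m\<rfloor> + 1. b k)"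
proof -
  let ?p = "nat \<lceil>real m / (4 * c)\<rceil>" and ?q = "nat \<lfloor>c * real m\<rfloor> + 1"
  define S where "S = (\<Sum>k=?p..?q. b k)"
  \<comment> \<open>The lower end is m/2 rounded up, so m \<le> 2 \<open>\<nu>\<close> on
    \<open>A\<close>; the cardinality m div 2 + 1 is at least m/2.\<close>
  define A where "A = {m - m div 2..m}"
  have mpos: "real m > 0" using m c by linarith
  then have "real m / (4 * c) > 0" using c by simp
  then have p1: "1 \<le> ?p" by linarith
  then have bnn: "b k \<ge> 0" if "?p \<le> k" for k using nonneg[of k] that by linarith
  have sub: "sum b B \<le> S" if "B \<subseteq> {?p..?q}" for B
    unfolding S_def by (rule sum_mono2) (use that bnn in auto)
  have S: "S \<ge> 0" using sub[of "{}"] by simp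
  have "1 * real m \<le> c * real m" using c by (intro mult_right_mono) auto
  then have mq: "m \<le> nat \<lfloor>c * real m\<rfloor>" by (simp add: le_nat_iff le_floor_iff)
  have A: "?p \<le> \<nu>" "\<nu> + 1 \<le> ?q" "m \<le> 2 * \<nu>" "\<nu> \<le> m" if "\<nu> \<in> A" for \<nu>
  proof -
    show 2: "m \<le> 2 * \<nu>" "\<nu> \<le> m" using that by (auto simp: A_def)
    then show "\<nu> + 1 \<le> ?q" using mq by simp
    have "real m / (4 * c) \<le> real m / 2" using c by (intro divide_left_mono) auto
    also have "\<dots> \<le> real \<nu>" using 2 by simp
    finally show "?p \<le> \<nu>" by (simp add: nat_le_iff ceiling_le_iff)
  qed
  have "real (card A) * b m = (\<Sum>\<nu>\<in>A. b m)" by simp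
  also have "\<dots> \<le> (\<Sum>\<nu>\<in>A. (1 + K) * (b \<nu> + b (\<nu>+1)) + K * (4 * c / real m * S))"
  proof (rule sum_mono)
    fix \<nu> assume "\<nu> \<in> A"
    note \<nu> = A[OF this]
    let ?I = "{max 1 (nat \<lfloor>real \<nu> / c\<rfloor>)..nat \<lfloor>c * real \<nu>\<rfloor>}"
    have \<nu>1: "1 \<le> \<nu>" using p1 \<nu>(1) by (rule order.trans)
    have \<nu>c: "2 * c \<le> real \<nu>" using \<nu>(3) m by linarith
    have k4: "real m / (4 * c) \<le> real k" if "k \<in> ?I" for k
    proof -
      have "real m / (4 * c) \<le> (2 * real \<nu>) / (4 * c)"
        using \<nu>(3) c by (intro divide_right_mono) auto
      also have "\<dots> = real \<nu> / (2 * c)" by simp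
      also have "\<dots> \<le> real (nat \<lfloor>real \<nu> / c\<rfloor>)"
        using floor_divide_ge_half[OF _ \<nu>c] c by simp
      also have "\<dots> \<le> real k" using that by simp
      finally show ?thesis .
    qed
    have I: "?I \<subseteq> {?p..?q}"
    proof
      fix k assume k: "k \<in> ?I"
      have "?p \<le> k" using k4[OF k] by (simp add: nat_le_iff ceiling_le_iff)
      moreover have "nat \<lfloor>c * real \<nu>\<rfloor> \<le> nat \<lfloor>c * real m\<rfloor>"
        using \<nu>(4) c by (intro nat_mono floor_mono mult_left_mono) auto
      ultimately show "k \<in> {?p..?q}" using k by simp
    qed
    have "(\<Sum>k\<in>?I. b k / real k) \<le> (\<Sum>k\<in>?I. 4 * c / real m * b k)"
    proof (rule sum_mono)
      fix k assume k: "k \<in> ?I"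
      have "b k / real k \<le> b k / (real m / (4 * c))"
        using k4[OF k] bnn[of k] I k mpos c by (intro divide_left_mono) auto
      then show "b k / real k \<le> 4 * c / real m * b k" by (simp add: mult.commute)
    qed
    also have "\<dots> \<le> 4 * c / real m * S"
      unfolding sum_distrib_left[symmetric] using I sub c by (intro mult_left_mono) auto
    finally have sumI: "(\<Sum>k\<in>?I. b k / real k) \<le> 4 * c / real m * S" .
    have "b m \<le> b \<nu> + b (\<nu>+1) + (\<Sum>n=\<nu>..<m. \<bar>b n - b (n+2)\<bar>)"
      using term_le_variation[of b \<nu> "m - \<nu>"] nonneg \<nu>1 \<nu>(4) by simp
    \<comment> \<open>From m \<le> 2 \<open>\<nu>\<close>, the chain up to m stays inside the dyadic
      block of \<open>\<nu>\<close>, where GM applies.\<close>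
    also have "(\<Sum>n=\<nu>..<m. \<bar>b n - b (n+2)\<bar>) \<le> (\<Sum>n=\<nu>..2*\<nu>-1. \<bar>b n - b (n+2)\<bar>)"
      using \<nu>(3) by (intro sum_mono2) auto
    also have "\<dots> \<le> K * (b \<nu> + b (\<nu>+1) + (\<Sum>k\<in>?I. b k / real k))"
      by (rule GM[OF \<nu>1])
    also have "\<dots> \<le> K * (b \<nu> + b (\<nu>+1) + 4 * c / real m * S)"
      by (intro mult_left_mono add_left_mono sumI K)
    finally show "b m \<le> (1 + K) * (b \<nu> + b (\<nu>+1)) + K * (4 * c / real m * S)"
      by (simp add: algebra_simps)
  qed
  also have "\<dots> = (1 + K) * (sum b A + sum b (Suc ` A)) + real (card A) * (K * (4 * c / real m * S))"
    by (simp add: sum.distrib sum_distrib_left[symmetric] sum.reindex)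
  \<comment> \<open>Both \<open>A\<close> and its shift lie in the window, hence S twice; card
    \<open>A\<close> \<le> m cancels the 1/m of the window average.\<close>
  also have "\<dots> \<le> (1 + K) * (S + S) + real m * (K * (4 * c / real m * S))"
  proof (intro add_mono mult_left_mono mult_right_mono sub)
    show "A \<subseteq> {?p..?q}" "Suc ` A \<subseteq> {?p..?q}" using A(1,2) by force+
    have "1 < m" using m c by linarith
    then show "real (card A) \<le> real m" by (simp add: A_def)
  qed (use K c S in auto)
  also have "\<dots> = (2 * (1 + K) + 4 * c * K) * S"
    using mpos by (simp add: algebra_simps)
  finally have "real (card A) * b m \<le> (2 * (1 + K) + 4 * c * K) * S" .
  moreover have "real m / 2 * b m \<le> real (card A) * b m"
    using mpos nonneg[of m] by (intro mult_right_mono) (auto simp: A_def)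
  ultimately show ?thesis unfolding S_def[symmetric] by (simp add: algebra_simps)
qed

text \<open>The Cauchy condition is tested at x = 1/q, a point that moves with m; this is where
  uniformity in x enters. For p \<le> k \<le> q the argument k/q lies between 1/(8 c^2) and 1, so
  its sine is at least 1/(16 c^2).\<close>

lemma tendsto_if_uniformly_convergent:
  assumes "uniformly_convergent_on UNIV (\<lambda>N x. \<Sum>n = 1..N. b n * sin (real n * x))"
  shows "(\<lambda>n. real n * b n) \<longlonglongrightarrow> 0"
proof (rule LIMSEQ_I)
  fix e :: real assume e: "e > 0"
  define C where "C = 4 * (1 + K) + 8 * c * K"
  have C: "C > 0" using K c by (simp add: C_def add_pos_nonneg)
  \<comment> \<open>The window sum will be below 16 c^2 \<open>\<epsilon>\<close>, and the factor
    \<open>C\<close> from \<open>term_le_window_sum\<close> turns this into e.\<close>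
  define \<epsilon> where "\<epsilon> = e / (16 * c^2 * C)"
  have \<epsilon>: "\<epsilon> > 0" using e C c by (simp add: \<epsilon>_def)
  have "uniformly_Cauchy_on UNIV (\<lambda>N x. \<Sum>n = 1..N. b n * sin (real n * x))"
    using assms by (simp add: uniformly_convergent_Cauchy)
  then obtain M where M: "\<And>x m n. M \<le> m \<Longrightarrow> M \<le> n \<Longrightarrow>
      dist (\<Sum>n = 1..m. b n * sin (real n * x)) (\<Sum>n = 1..n. b n * sin (real n * x)) < \<epsilon>"
    using \<epsilon> unfolding uniformly_Cauchy_on_def by blast
  show "\<exists>N. \<forall>m\<ge>N. norm (real m * b m - 0) < e"
  \<comment> \<open>The threshold forces p \<ge> \<open>M\<close> + 1, so that even the partial sum
    up to p - 1 is in the Cauchy range.\<close>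
  proof (intro exI[of _ "nat \<lceil>4 * c * (real M + 1)\<rceil>"] allI impI)
    fix m assume "nat \<lceil>4 * c * (real M + 1)\<rceil> \<le> m"
    then have m: "4 * c * (real M + 1) \<le> real m" by (simp add: nat_le_iff ceiling_le_iff)
    moreover have "4 * c * 1 \<le> 4 * c * (real M + 1)" using c by (intro mult_left_mono) auto
    ultimately have m4: "4 * c \<le> real m" by linarith
    then have m1: "1 \<le> m" using c by linarith
    define p where "p = nat \<lceil>real m / (4 * c)\<rceil>"
    define q where "q = nat \<lfloor>c * real m\<rfloor> + 1"
    have p: "real m / (4 * c) \<le> real p" unfolding p_def by (rule real_nat_ceiling_ge)
    have "real M + 1 \<le> real m / (4 * c)" using m c by (simp add: field_simps)
    then have pM: "M + 1 \<le> p" using p by linarith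
    \<comment> \<open>Since cm \<ge> 1, the \<open>+ 1\<close> in \<open>q\<close> is absorbed by
      doubling cm.\<close>
    have "1 * 1 \<le> c * real m" using c m1 by (intro mult_mono) auto
    then have q: "real q \<le> 2 * c * real m" unfolding q_def by linarith
    have qpos: "real q > 0" by (simp add: q_def)
    have "1 / (16 * c^2) = (real m / (4 * c)) / (2 * (2 * c * real m))"
      using m1 c by (simp add: field_simps power2_eq_square)
    also have "\<dots> \<le> real p / (2 * real q)"
      using p q qpos m1 c by (intro frac_le) auto
    finally have ratio: "1 / (16 * c^2) \<le> real p / (2 * real q)" .
    have "1 / (16 * c^2) * (\<Sum>k=p..q. b k) = (\<Sum>k=p..q. b k * (1 / (16 * c^2)))"
      by (subst sum_distrib_left) (simp only: mult.commute)
    also have "\<dots> \<le> (\<Sum>k=p..q. b k * sin (real k * (1 / real q)))"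
    proof (intro sum_mono mult_left_mono)
      fix k assume k: "k \<in> {p..q}"
      show "b k \<ge> 0" using nonneg[of k] k pM by simp
      have "1 / (16 * c^2) \<le> real p / (2 * real q)" by (rule ratio)
      also have "\<dots> \<le> (real k * (1 / real q)) / 2"
        using k qpos by (simp add: frac_le)
      also have "\<dots> \<le> sin (real k * (1 / real q))"
        using k qpos by (intro sin_ge_half) auto
      finally show "1 / (16 * c^2) \<le> sin (real k * (1 / real q))" .
    qed
    also have "\<dots> < \<epsilon>"
    proof (cases "p \<le> q")
      case True
      then have "(\<Sum>n = 1..q. b n * sin (real n * (1 / real q)))
          = (\<Sum>n = 1..p-1. b n * sin (real n * (1 / real q))) + (\<Sum>n = p..q. b n * sin (real n * (1 / real q)))"
        using sum.ub_add_nat[of 1 "p-1" _ "q - (p - 1)"] pM by simp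
      moreover have "M \<le> p - 1" "M \<le> q" using pM True by simp_all
      ultimately show ?thesis using M[of "p-1" q "1 / real q"] unfolding dist_real_def by linarith
    qed (use \<epsilon> in simp)
    finally have "(\<Sum>k=p..q. b k) < 16 * c^2 * \<epsilon>"
      using c by (simp add: field_simps)
    then have "C * (\<Sum>k=p..q. b k) < C * (16 * c^2 * \<epsilon>)" using C by simp
    also have "\<dots> = e" using C c by (simp add: \<epsilon>_def)
    finally have "real m * b m < e"
      using term_le_window_sum[OF m4] unfolding C_def p_def q_def by linarith
    then show "norm (real m * b m - 0) < e" using nonneg[OF m1] by simp
  qed
qed

end

section \<open>Passage from the complex class to real sequences\<close>

theorem corollary2:
  fixes b :: "nat \<Rightarrow> real"
  assumes nonneg: "\<And>n. n \<ge> 1 \<Longrightarrow> b n \<ge> 0"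
    and GM: "(\<lambda>n. complex_of_real (b n)) \<in> GM_beta_star 2"
  shows "uniformly_convergent_on (UNIV :: real set)
           (\<lambda>N x. \<Sum>n = 1..N. b n * sin (real n * x))
         \<longleftrightarrow> (\<lambda>n. real n * b n) \<longlonglongrightarrow> 0"
proof -
  let ?a = "\<lambda>n. complex_of_real (b n)"
  obtain c K where c: "c > 1" and K: "\<And>m. m \<ge> 1 \<Longrightarrow>
      (\<Sum>n = m..2 * m - 1. cmod (?a n - ?a (n + 2))) \<le> K * beta_star 2 c ?a m"
    using GM unfolding GM_beta_star_def by blast
  \<comment> \<open>Nothing fixes the sign of \<open>K\<close>, but \<open>beta_star\<close> is
    nonnegative, so |K| also works and meets the requirement K \<ge> 0 of the context.\<close>
  have GM': "(\<Sum>n=m..2*m-1. \<bar>b n - b (n+2)\<bar>) \<le> \<bar>K\<bar> *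
      (b m + b (m+1) + (\<Sum>k = max 1 (nat \<lfloor>real m / c\<rfloor>)..nat \<lfloor>c * real m\<rfloor>. b k / real k))"
    if m: "m \<ge> 1" for m
  proof -
    have "beta_star 2 c ?a m =
        b m + b (m+1) + (\<Sum>k = max 1 (nat \<lfloor>real m / c\<rfloor>)..nat \<lfloor>c * real m\<rfloor>. b k / real k)"
      unfolding beta_star_def using nonneg m by (simp add: numeral_2_eq_2)
    moreover have "beta_star 2 c ?a m \<ge> 0"
      unfolding beta_star_def by (intro add_nonneg_nonneg sum_nonneg) auto
    then have "K * beta_star 2 c ?a m \<le> \<bar>K\<bar> * beta_star 2 c ?a m"
      by (intro mult_right_mono) auto
    moreover have "cmod (?a n - ?a (n + 2)) = \<bar>b n - b (n + 2)\<bar>" for n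
      by (metis norm_of_real of_real_diff)
    ultimately show ?thesis using K[OF m] by simp
  qed
  show ?thesis
    using uniformly_convergent_if_tendsto[OF nonneg c abs_ge_zero GM']
      tendsto_if_uniformly_convergent[OF nonneg c abs_ge_zero GM'] by blast
qed

end
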